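(* Let $F$ be a field of characteristic $0$ and let $\mathcal{R}=\{J_a\circ l_r\mid a\in F,\ r\in F[x]\setminus\{0\}\}$. For $b\in F$ and $s\in F[x]$ with $s(b)=0$ consider the maps $h^b_s,h^{b,2}_s\colon\mathcal{R}\to\mathcal{R}$ given by $$h^b_s\colon J_a\circ l_r\mapsto J_a\circ l_{r+r(b)s},\qquad h^{b,2}_s\colon J_a\circ l_r\mapsto J_a\circ l_{r+r(b)^2s}.$$ Then the group generated by $\{h^{b,2}_s,\,h^b_s\mid b\in F,\ s\in F[x],\ s(b)=0\}$ acts infinitely transitively on $\mathcal{R}^a=\{J_a\circ l_r\mid r\in F[x]\setminus\{0\}\}$ for any $a\in F$.
   Context: On $F[x]$: $l_r\colon f\mapsto rf$ is multiplication by $r\in F[x]$; for $a\in F$, $J_a$ is the linear operator with $J_a(x^n)=\frac{x^{n+1}-a^{n+1}}{n+1}$ for $n\ge0$; $\circ$ is composition. The map $(a,r)\mapsto J_a\circ l_r$ is a bijection $F\times(F[x]\setminus\{0\})\to\mathcal{R}$, so the maps above are well defined. They are bijections of $\mathcal{R}$ preserving each $\mathcal{R}^a$; replacing $s$ by $\gamma s$, $\gamma\in F$, yields actions of the additive group $\mathbb{G}_a=(F,+)$. A group $G$ acts infinitely transitively on a set $S$ if for every $m\in\mathbb{N}$ it acts transitively on the set of ordered $m$-tuples of pairwise distinct points of $S$. *)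

theory Defs
  imports
    "HOL-Computational_Algebra.Polynomial"
    "HOL-Algebra.Group_Action"
    "HOL-Algebra.Generated_Groups"
begin

definition mult_op :: "'a::field_char_0 poly \<Rightarrow> 'a poly \<Rightarrow> 'a poly"
  where "mult_op r = (\<lambda>f. r * f)"

text \<open>The linear extension of \<open>x^n \<mapsto> (x^(n+1) - a^(n+1)) / (n+1)\<close>; see \<open>int_op_monom\<close>,
  \<open>int_op_add\<close>, \<open>int_op_smult\<close>.\<close>

definition int_op :: "'a::field_char_0 \<Rightarrow> 'a poly \<Rightarrow> 'a poly"
  where "int_op a f =
    (\<Sum>n\<le>degree f. smult (coeff f n) (smult (1 / of_nat (n + 1)) (monom 1 (n + 1) - [:a ^ (n + 1):])))"

lemma int_op_bound:
  assumes "degree f \<le> N"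
  shows "int_op a f =
    (\<Sum>n\<le>N. smult (coeff f n) (smult (1 / of_nat (n + 1)) (monom 1 (n + 1) - [:a ^ (n + 1):])))"
  unfolding int_op_def
  by (rule sum.mono_neutral_left) (use assms in \<open>auto simp: coeff_eq_0\<close>)

lemma int_op_monom:
  "int_op a (monom 1 n) = smult (1 / of_nat (n + 1)) (monom 1 (n + 1) - [:a ^ (n + 1):])"
proof -
  have "int_op a (monom 1 n) = (\<Sum>k\<le>n. if k = n
      then smult (1 / of_nat (n + 1)) (monom 1 (n + 1) - [:a ^ (n + 1):]) else 0)"
    unfolding int_op_bound[OF degree_monom_le] by (rule sum.cong) auto
  then show ?thesis by simp
qed

lemma int_op_add: "int_op a (f + g) = int_op a f + int_op a g"
proof -
  define N where "N = max (degree f) (degree g)"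
  have N: "degree f \<le> N" "degree g \<le> N" "degree (f + g) \<le> N"
    by (auto simp: N_def intro: degree_add_le)
  show ?thesis
    by (simp only: int_op_bound[OF N(1)] int_op_bound[OF N(2)] int_op_bound[OF N(3)]
        coeff_add smult_add_left sum.distrib)
qed

lemma int_op_smult: "int_op a (smult c f) = smult c (int_op a f)"
proof -
  have "smult c (sum g A) = (\<Sum>n\<in>A. smult c (g n))" for g :: "nat \<Rightarrow> 'a poly" and A
    by (induction A rule: infinite_finite_induct) (auto simp: smult_add_right)
  then show ?thesis
    by (simp only: int_op_bound[OF degree_smult_le] int_op_def[of a f] coeff_smult smult_smult mult.assoc)
qed

definition ops_at :: "'a::field_char_0 \<Rightarrow> ('a poly \<Rightarrow> 'a poly) set"
  where "ops_at a = {int_op a \<circ> mult_op r | r. r \<noteq> 0}"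

definition ops :: "('a::field_char_0 poly \<Rightarrow> 'a poly) set"
  where "ops = {int_op a \<circ> mult_op r | a r. r \<noteq> 0}"

text \<open>The transformation \<open>J\<^sub>a \<circ> l\<^sub>r \<mapsto> J\<^sub>a \<circ> l\<^sub>t\<close> with \<open>t = r + r(b)^k * s\<close>.
  The description is well defined because \<open>(a, r) \<mapsto> J\<^sub>a \<circ> l\<^sub>r\<close> is injective on \<open>r \<noteq> 0\<close>.
  As required by \<^const>\<open>BijGroup\<close>, the map is \<^const>\<open>undefined\<close> outside \<^const>\<open>ops\<close>.\<close>

definition h_pow :: "nat \<Rightarrow> 'a::field_char_0 \<Rightarrow> 'a poly \<Rightarrow> ('a poly \<Rightarrow> 'a poly) \<Rightarrow> ('a poly \<Rightarrow> 'a poly)"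
  where "h_pow k b s = (\<lambda>P\<in>ops. THE Q. \<exists>a r. r \<noteq> 0 \<and> P = int_op a \<circ> mult_op r \<and>
    Q = int_op a \<circ> mult_op (r + smult (poly r b ^ k) s))"

abbreviation h_lin :: "'a::field_char_0 \<Rightarrow> 'a poly \<Rightarrow> ('a poly \<Rightarrow> 'a poly) \<Rightarrow> ('a poly \<Rightarrow> 'a poly)"
  where "h_lin \<equiv> h_pow 1"

abbreviation h_sq :: "'a::field_char_0 \<Rightarrow> 'a poly \<Rightarrow> ('a poly \<Rightarrow> 'a poly) \<Rightarrow> ('a poly \<Rightarrow> 'a poly)"
  where "h_sq \<equiv> h_pow 2"

definition h_group :: "(('a::field_char_0 poly \<Rightarrow> 'a poly) \<Rightarrow> ('a poly \<Rightarrow> 'a poly)) monoid"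
  where "h_group = (BijGroup ops)
    \<lparr>carrier := generate (BijGroup ops)
      ({h_sq b s | b s. poly s b = 0} \<union> {h_lin b s | b s. poly s b = 0})\<rparr>"

definition distinct_tuples :: "nat \<Rightarrow> 'b set \<Rightarrow> 'b list set"
  where "distinct_tuples m S = {xs. length xs = m \<and> distinct xs \<and> set xs \<subseteq> S}"

definition infinitely_transitive_action ::
    "('g, 'c) monoid_scheme \<Rightarrow> 'b set \<Rightarrow> ('g \<Rightarrow> 'b \<Rightarrow> 'b) \<Rightarrow> bool"
  where "infinitely_transitive_action G S \<phi> \<longleftrightarrow> group_action G S \<phi> \<and>
    (\<forall>m. transitive_action G (distinct_tuples m S) (\<lambda>g. \<lambda>xs\<in>distinct_tuples m S. map (\<phi> g) xs))"

end

theory Submission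
  imports Defs
begin

text \<open>Since \<open>J\<^sub>a \<circ> l\<^sub>r\<close> determines \<open>a\<close> and \<open>r\<close> (\<open>int_mult_op_inject\<close>), the action on
  \<open>\<R>\<^sup>a\<close> is an action on the nonzero polynomials, and its generators are shears
  \<open>r \<mapsto> r + f(r(b)) s\<close> with \<open>s(b) = 0\<close> and \<open>f(y) = y\<close> or \<open>f(y) = y\<^sup>2\<close>. A shear at \<open>b\<close> does not change
  the value \<open>r(b)\<close>, which is why it is invertible and why shears at the same point add up.

  The two profiles \<open>y\<close> and \<open>y\<^sup>2\<close> generate all others: for fixed \<open>b\<close>, the functions \<open>f\<close> for which every
  shear \<open>r \<mapsto> r + f(r(b)) s\<close> comes from the group form a vector space, and this space is closed under
  squaring. To get \<open>f\<^sup>2\<close>, use a shear at \<open>b\<close> to change the value of \<open>r\<close> at a second point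
  \<open>c\<close> from \<open>r(c)\<close> to \<open>r(c) \<plusminus> f(r(b))\<close>, apply the quadratic shear at \<open>c\<close>, and undo the change; the
  identity \<open>(x + y)\<^sup>2 + (x - y)\<^sup>2 - 2 x\<^sup>2 = 2 y\<^sup>2\<close> removes \<open>r(c)\<close>
  (\<open>realised_shear_square_aux\<close>). In characteristic \<open>0\<close> closure under squares gives closure under products,
  so every polynomial profile without constant term is available.

  Interpolation then moves one polynomial alone. If \<open>r(b)\<close> is nonzero and differs from \<open>p(b)\<close> for all \<open>p\<close>
  in a finite set \<open>A\<close>, a profile that vanishes at the values \<open>p(b)\<close> but not at \<open>r(b)\<close>
  translates \<open>r\<close> by any multiple of \<open>x - b\<close> and fixes \<open>A\<close> pointwise. Two such translations, at two
  generic points, carry \<open>r\<close> to any prescribed nonzero polynomial outside \<open>A\<close> (\<open>move_one\<close>).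
  Replacing the entries one by one carries a tuple to any disjoint tuple, and two arbitrary tuples
  are joined through a third one that is disjoint from both.\<close>

section \<open>The operators determine the point and the polynomial\<close>

lemma pderiv_int_op: "pderiv (int_op a f) = f"
proof -
  have "pderiv (smult (1 / of_nat (n + 1)) (monom 1 (n + 1) - [:a ^ (n + 1):])) = monom 1 n" for n
  proof -
    have "(of_nat (n + 1) :: 'a) \<noteq> 0"
      by (simp only: of_nat_eq_0_iff)
    then show ?thesis
      by (simp add: pderiv_smult pderiv_diff pderiv_monom smult_monom del: of_nat_Suc of_nat_add)
  qed
  then have "pderiv (int_op a f) = (\<Sum>n\<le>degree f. smult (coeff f n) (monom 1 n))"
    unfolding int_op_def by (simp only: higher_pderiv_sum[where n = 1, simplified] pderiv_smult[of "coeff _ _"])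
  then show ?thesis
    by (simp add: smult_monom poly_as_sum_of_monoms)
qed

lemma poly_int_op_basepoint: "poly (int_op a f) a = 0"
  by (simp add: int_op_def poly_sum poly_monom)

lemma poly_int_op_pderiv: "poly (int_op a (pderiv f)) x = poly f x - poly f a"
proof -
  have "pderiv (int_op a (pderiv f) - f) = 0"
    by (simp add: pderiv_diff pderiv_int_op)
  then obtain c where c: "int_op a (pderiv f) - f = [:c:]"
    using pderiv_iszero by blast
  then have eq: "int_op a (pderiv f) = f + [:c:]"
    by (simp add: algebra_simps)
  show ?thesis
    using poly_int_op_basepoint[of a "pderiv f"] unfolding eq by (simp add: algebra_simps add_eq_0_iff2)
qed

text \<open>This is what makes the base point visible in \<open>J\<^sub>a \<circ> l\<^sub>r\<close>: the increment of \<open>f\<close> between \<open>a\<close> and \<open>b\<close> is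
  the integral of \<open>f'\<close>, so the integral from \<open>a\<close> to \<open>b\<close> does not vanish on the whole
  ideal \<open>(r)\<close>. Write \<open>r = (x - a)\<^sup>k w\<close> with \<open>w(a) \<noteq> 0\<close>. If \<open>v\<close> vanishes at \<open>a\<close>, then \<open>(v\<^bsup>k+1\<^esup>)'\<close> contains the factor
  \<open>v\<^sup>k\<close>, which absorbs \<open>(x - a)\<^sup>k\<close>, and the factor \<open>v'\<close>, which absorbs \<open>w\<close> as soon as \<open>v\<close> is
  constant modulo \<open>w\<^sup>2\<close>.\<close>

lemma separating_poly_with_divisible_derivative:
  fixes r :: "'a::field_char_0 poly"
  assumes "r \<noteq> 0" and "a \<noteq> b"
  obtains f where "r dvd pderiv f" and "poly f a \<noteq> poly f b"
proof -
  obtain k w where r: "r = [:- a, 1:] ^ k * w" and w: "poly w a \<noteq> 0"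
    using order_decomp[OF assms(1), of a] by (auto simp: dvd_iff_poly_eq_0)
  \<comment> \<open>The factor \<open>x - b\<close> makes \<open>v\<close> equal to \<open>1\<close> at \<open>b\<close>, whatever the value of \<open>w\<close> there.\<close>
  define u where "u = w * [:- b, 1:]"
  define c where "c = poly u a"
  have c: "c \<noteq> 0"
    using w assms(2) by (simp add: c_def u_def)
  define v where "v = 1 - smult (1 / c ^ 2) (u ^ 2)"
  have va: "poly v a = 0" and vb: "poly v b = 1"
    using c by (simp_all add: v_def c_def[symmetric]) (simp add: u_def)
  have "[:- a, 1:] dvd v"
    using va by (simp add: dvd_iff_poly_eq_0)
  then have "[:- a, 1:] ^ k dvd v ^ k"
    by (rule dvd_power_same)
  moreover have "w dvd pderiv v"
  proof -
    have "w dvd u"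
      unfolding u_def by (rule dvd_triv_left)
    then show ?thesis
      unfolding v_def power2_eq_square pderiv_diff pderiv_smult pderiv_mult pderiv_1
      by (intro dvd_diff dvd_smult dvd_add dvd_mult2 dvd_0_right)
  qed
  ultimately have "r dvd v ^ k * pderiv v"
    unfolding r by (rule mult_dvd_mono)
  then have "r dvd pderiv (v ^ Suc k)"
    unfolding pderiv_power_Suc by (simp add: dvd_smult)
  moreover have "poly (v ^ Suc k) a \<noteq> poly (v ^ Suc k) b"
    using va vb by simp
  ultimately show thesis
    by (rule that)
qed

text \<open>Applied to the constant \<open>1\<close> and differentiated, \<open>J\<^sub>a \<circ> l\<^sub>r\<close> returns \<open>r\<close>. If also \<open>J\<^sub>a \<circ> l\<^sub>r = J\<^sub>b \<circ> l\<^sub>r\<close>, all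
  polynomials in the image vanish at both \<open>a\<close> and \<open>b\<close>, so no \<open>f\<close> with \<open>r\<close> dividing \<open>f'\<close> separates
  \<open>a\<close> from \<open>b\<close>.\<close>

lemma int_mult_op_inject:
  fixes r t :: "'a::field_char_0 poly"
  assumes eq: "int_op a \<circ> mult_op r = int_op b \<circ> mult_op t" and "r \<noteq> 0"
  shows "a = b \<and> r = t"
proof
  have eqs: "int_op a (r * f) = int_op b (t * f)" for f
    using fun_cong[OF eq, of f] by (simp add: mult_op_def)
  show rt: "r = t"
    using pderiv_int_op[of a "r * 1"] unfolding eqs pderiv_int_op by simp
  show "a = b"
  proof (rule ccontr)
    assume "a \<noteq> b"
    with \<open>r \<noteq> 0\<close> obtain f where "r dvd pderiv f" and f: "poly f a \<noteq> poly f b"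
      by (rule separating_poly_with_divisible_derivative)
    then obtain g where g: "pderiv f = r * g"
      by blast
    have "poly (int_op a (pderiv f)) b = poly (int_op b (pderiv f)) b"
      using eqs[of g] by (simp add: g rt)
    then show False
      using f by (simp add: poly_int_op_pderiv)
  qed
qed

section \<open>The generators are bijections\<close>

text \<open>Evaluation at \<open>b\<close>, where \<open>s\<close> vanishes, shows that the shear preserves \<open>r(b)\<close>; if the image were \<open>0\<close>,
  then \<open>r(b) = 0\<close>, and a shear fixes such an \<open>r\<close>.\<close>

lemma add_smult_value_nonzero:
  fixes r s :: "'a::field_char_0 poly"
  assumes "r \<noteq> 0" "poly s b = 0" "k > 0"
  shows "r + smult (poly r b ^ k) s \<noteq> 0"
proof
  assume *: "r + smult (poly r b ^ k) s = 0"
  then have "poly (r + smult (poly r b ^ k) s) b = 0"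
    by simp
  then have "poly r b = 0"
    using assms(2) by simp
  then show False
    using * assms(1,3) by (simp add: zero_power)
qed

lemma h_pow_apply:
  fixes r :: "'a::field_char_0 poly"
  assumes "r \<noteq> 0"
  shows "h_pow k b s (int_op a \<circ> mult_op r) = int_op a \<circ> mult_op (r + smult (poly r b ^ k) s)"
proof -
  have "int_op a \<circ> mult_op r \<in> ops"
    using assms by (auto simp: ops_def)
  moreover have "(THE Q. \<exists>c t. t \<noteq> 0 \<and> int_op a \<circ> mult_op r = int_op c \<circ> mult_op t \<and>
      Q = int_op c \<circ> mult_op (t + smult (poly t b ^ k) s)) =
      int_op a \<circ> mult_op (r + smult (poly r b ^ k) s)"
    using assms by (intro the_equality) (auto dest: int_mult_op_inject)
  ultimately show ?thesis
    by (simp add: h_pow_def)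
qed

lemma h_pow_maps_ops:
  assumes "poly s b = 0" "k > 0" "P \<in> ops"
  shows "h_pow k b s P \<in> ops"
  using assms by (fastforce simp: ops_def h_pow_apply dest: add_smult_value_nonzero)

lemma h_pow_cancel:
  assumes "poly s b = 0" "k > 0" "P \<in> ops"
  shows "h_pow k b (- s) (h_pow k b s P) = P"
  using assms by (auto simp: ops_def h_pow_apply add_smult_value_nonzero)

lemma h_pow_in_Bij:
  assumes "poly s b = 0" "k > 0"
  shows "h_pow k b s \<in> Bij ops"
proof -
  have "bij_betw (h_pow k b s) ops ops"
    using assms h_pow_cancel[of s b k] h_pow_cancel[of "- s" b k]
      h_pow_maps_ops[of s b k] h_pow_maps_ops[of "- s" b k]
    by (intro bij_betw_byWitness[where f' = "h_pow k b (- s)"]) auto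
  then show ?thesis
    by (simp add: Bij_def h_pow_def)
qed

lemma inv_h_pow:
  assumes "poly s b = 0" "k > 0"
  shows "inv\<^bsub>BijGroup ops\<^esub> (h_pow k b s) = h_pow k b (- s)"
proof (rule group.inv_equality[OF group_BijGroup])
  show "h_pow k b s \<in> carrier (BijGroup ops)" "h_pow k b (- s) \<in> carrier (BijGroup ops)"
    using assms by (auto simp: BijGroup_def intro: h_pow_in_Bij)
  show "h_pow k b (- s) \<otimes>\<^bsub>BijGroup ops\<^esub> h_pow k b s = \<one>\<^bsub>BijGroup ops\<^esub>"
    using assms by (auto simp: BijGroup_def h_pow_in_Bij compose_def h_pow_cancel)
qed

lemma subgroup_h_group: "subgroup (carrier h_group) (BijGroup ops)"
  unfolding h_group_def
  by (simp, rule group.generate_is_subgroup[OF group_BijGroup])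
    (auto simp: BijGroup_def intro: h_pow_in_Bij)

lemma group_h_group: "group h_group"
  using subgroup.subgroup_is_group[OF subgroup_h_group group_BijGroup] by (simp add: h_group_def)

lemma h_group_mult_apply:
  assumes "g \<in> carrier h_group" "h \<in> carrier h_group" "P \<in> ops"
  shows "(g \<otimes>\<^bsub>h_group\<^esub> h) P = g (h P)"
proof -
  have "g \<in> Bij ops" "h \<in> Bij ops"
    using subgroup.subset[OF subgroup_h_group] assms by (auto simp: BijGroup_def)
  then show ?thesis
    using assms(3) by (simp add: h_group_def BijGroup_def compose_def)
qed

lemma ops_at_subset_ops: "ops_at a \<subseteq> ops"
  by (auto simp: ops_at_def ops_def)

lemma h_pow_maps_ops_at:
  assumes "poly s b = 0" "k > 0" "P \<in> ops_at a"
  shows "h_pow k b s P \<in> ops_at a"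
  using assms by (fastforce simp: ops_at_def h_pow_apply dest: add_smult_value_nonzero)

lemma generator_is_h_pow:
  assumes "h \<in> {h_sq b s | b s. poly s b = 0} \<union> {h_lin b s | b s. poly s b = 0}"
  shows "\<exists>k b s. h = h_pow k b s \<and> poly s b = 0 \<and> k > 0"
  using assms
proof
  assume "h \<in> {h_sq b s | b s. poly s b = 0}"
  then obtain b s where "h = h_sq b s" "poly s b = 0"
    by blast
  then show ?thesis
    by (intro exI[of _ 2] exI[of _ b] exI[of _ s]) simp
next
  assume "h \<in> {h_lin b s | b s. poly s b = 0}"
  then obtain b s where "h = h_lin b s" "poly s b = 0"
    by blast
  then show ?thesis
    by (intro exI[of _ 1] exI[of _ b] exI[of _ s]) simp
qed

lemma h_group_maps_ops_at:
  assumes "g \<in> carrier h_group"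
  shows "g \<in> ops_at a \<rightarrow> ops_at a"
proof -
  have "g \<in> generate (BijGroup ops)
      ({h_sq b s | b s. poly s b = 0} \<union> {h_lin b s | b s. poly s b = 0})"
    using assms by (simp add: h_group_def)
  then show ?thesis
  proof (induction rule: generate.induct)
    case one
    then show ?case
      using ops_at_subset_ops[of a] by (auto simp: BijGroup_def)
  next
    case (incl h)
    then obtain k b s where "h = h_pow k b s" "poly s b = 0" "k > 0"
      using generator_is_h_pow[OF incl.hyps] by (elim exE conjE)
    then show ?case
      by (simp add: h_pow_maps_ops_at)
  next
    case (inv h)
    then obtain k b s where "h = h_pow k b s" "poly s b = 0" "k > 0"
      using generator_is_h_pow[OF inv.hyps] by (elim exE conjE)
    then show ?case
      by (simp add: inv_h_pow h_pow_maps_ops_at)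
  next
    case (eng g h)
    then have "g \<in> carrier h_group" "h \<in> carrier h_group"
      by (simp_all add: h_group_def)
    then have "(g \<otimes>\<^bsub>BijGroup ops\<^esub> h) P = g (h P)" if "P \<in> ops_at a" for P
      using that ops_at_subset_ops[of a] h_group_mult_apply[of g h P]
      by (simp add: h_group_def subset_iff)
    then show ?case
      using eng.IH by (simp add: Pi_iff)
  qed
qed

section \<open>Group actions from pointwise laws\<close>

text \<open>Bijectivity of each \<open>\<phi> g\<close> is automatic, because \<open>\<phi> (inv g)\<close> is an inverse map.\<close>

lemma group_action_by_laws:
  assumes "group G"
    and maps: "\<And>g. g \<in> carrier G \<Longrightarrow> \<phi> g \<in> E \<rightarrow>\<^sub>E E"
    and one: "\<And>x. x \<in> E \<Longrightarrow> \<phi> \<one>\<^bsub>G\<^esub> x = x"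
    and mult: "\<And>g h x. g \<in> carrier G \<Longrightarrow> h \<in> carrier G \<Longrightarrow> x \<in> E \<Longrightarrow>
      \<phi> (g \<otimes>\<^bsub>G\<^esub> h) x = \<phi> g (\<phi> h x)"
  shows "group_action G E \<phi>"
proof -
  interpret group G
    by fact
  have "bij_betw (\<phi> g) E E" if "g \<in> carrier G" for g
  proof (rule bij_betw_byWitness[where f' = "\<phi> (inv\<^bsub>G\<^esub> g)"])
    show "\<forall>x\<in>E. \<phi> (inv\<^bsub>G\<^esub> g) (\<phi> g x) = x"
      using that one by (simp flip: mult)
    show "\<forall>x\<in>E. \<phi> g (\<phi> (inv\<^bsub>G\<^esub> g) x) = x"
      using that one by (simp flip: mult)
    show "\<phi> g ` E \<subseteq> E" "\<phi> (inv\<^bsub>G\<^esub> g) ` E \<subseteq> E"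
      using that maps[of g] maps[of "inv\<^bsub>G\<^esub> g"] by (auto dest: PiE_mem)
  qed
  then have bij: "\<phi> g \<in> Bij E" if "g \<in> carrier G" for g
    using that maps[of g] by (auto simp: Bij_def PiE_def)
  have "\<phi> (g \<otimes>\<^bsub>G\<^esub> h) = compose E (\<phi> g) (\<phi> h)" if "g \<in> carrier G" "h \<in> carrier G" for g h
  proof (rule extensionalityI[where A = E])
    show "\<phi> (g \<otimes>\<^bsub>G\<^esub> h) \<in> extensional E"
      using that maps[of "g \<otimes>\<^bsub>G\<^esub> h"] by (auto simp: PiE_def)
    show "\<phi> (g \<otimes>\<^bsub>G\<^esub> h) x = compose E (\<phi> g) (\<phi> h) x" if "x \<in> E" for x
      using that \<open>g \<in> carrier G\<close> \<open>h \<in> carrier G\<close> by (simp add: mult compose_eq)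
  qed simp
  then have "\<phi> \<in> hom G (BijGroup E)"
    by (intro homI) (auto simp: BijGroup_def bij)
  then show ?thesis
    unfolding group_action_def group_hom_def group_hom_axioms_def
    using \<open>group G\<close> group_BijGroup by blast
qed

lemma group_action_distinct_tuples:
  assumes "group_action G E \<phi>"
  shows "group_action G (distinct_tuples m E) (\<lambda>g. \<lambda>xs\<in>distinct_tuples m E. map (\<phi> g) xs)"
proof -
  interpret group_action G E \<phi>
    by fact
  have maps: "map (\<phi> g) xs \<in> distinct_tuples m E"
    if "g \<in> carrier G" "xs \<in> distinct_tuples m E" for g xs
    using that inj_prop[of g] surj_prop[of g]
    by (auto simp: distinct_tuples_def distinct_map intro: inj_on_subset)
  show ?thesis
  proof (rule group_action_by_laws)
    show "group G"
      using group_hom by (simp add: group_hom_def)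
    show "(\<lambda>xs\<in>distinct_tuples m E. map (\<phi> g) xs) \<in> distinct_tuples m E \<rightarrow>\<^sub>E distinct_tuples m E"
      if "g \<in> carrier G" for g
      using that maps by auto
    show "(\<lambda>xs\<in>distinct_tuples m E. map (\<phi> \<one>\<^bsub>G\<^esub>) xs) xs = xs" if "xs \<in> distinct_tuples m E" for xs
      using that by (auto simp: distinct_tuples_def id_eq_one[symmetric] intro!: map_idI)
    show "(\<lambda>xs\<in>distinct_tuples m E. map (\<phi> (g \<otimes>\<^bsub>G\<^esub> h)) xs) xs =
        (\<lambda>xs\<in>distinct_tuples m E. map (\<phi> g) xs) ((\<lambda>xs\<in>distinct_tuples m E. map (\<phi> h) xs) xs)"
      if "g \<in> carrier G" "h \<in> carrier G" "xs \<in> distinct_tuples m E" for g h xs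
      using that maps by (auto simp: distinct_tuples_def composition_rule)
  qed
qed

lemma group_action_h_group: "group_action h_group (ops_at a) (\<lambda>g. restrict g (ops_at a))"
proof (rule group_action_by_laws[OF group_h_group])
  show "restrict g (ops_at a) \<in> ops_at a \<rightarrow>\<^sub>E ops_at a" if "g \<in> carrier h_group" for g
    using h_group_maps_ops_at[OF that] by simp
  show "restrict \<one>\<^bsub>h_group\<^esub> (ops_at a) P = P" if "P \<in> ops_at a" for P
    using that ops_at_subset_ops by (auto simp: h_group_def BijGroup_def)
  show "restrict (g \<otimes>\<^bsub>h_group\<^esub> h) (ops_at a) P = restrict g (ops_at a) (restrict h (ops_at a) P)"
    if "g \<in> carrier h_group" "h \<in> carrier h_group" "P \<in> ops_at a" for g h P
    using that h_group_maps_ops_at[of h a] ops_at_subset_ops[of a]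
    by (simp add: h_group_mult_apply subset_iff Pi_iff)
qed

section \<open>Shears of the nonzero polynomials\<close>

text \<open>The polynomial-level description of the group: \<open>\<psi>\<close> is the effect of one group element on the
  coordinate \<open>r\<close> of \<open>J\<^sub>a \<circ> l\<^sub>r\<close>, simultaneously for all \<open>a\<close>. The value of \<open>\<psi>\<close> at \<open>0\<close> is
  unconstrained.\<close>

definition realised :: "('a::field_char_0 poly \<Rightarrow> 'a poly) \<Rightarrow> bool"
  where "realised \<psi> \<longleftrightarrow> (\<exists>g \<in> carrier h_group. \<forall>a r. r \<noteq> 0 \<longrightarrow>
    \<psi> r \<noteq> 0 \<and> g (int_op a \<circ> mult_op r) = int_op a \<circ> mult_op (\<psi> r))"

lemma realised_id: "realised (\<lambda>r. r)"
proof -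
  have "\<one>\<^bsub>h_group\<^esub> (int_op a \<circ> mult_op r) = int_op a \<circ> mult_op r" if "r \<noteq> 0"
    for a :: 'a and r
    using that by (auto simp: h_group_def BijGroup_def ops_def)
  then show ?thesis
    unfolding realised_def using group.is_monoid[OF group_h_group] monoid.one_closed by blast
qed

lemma realised_comp:
  fixes \<psi> \<chi> :: "'a::field_char_0 poly \<Rightarrow> 'a poly"
  assumes "realised \<psi>" "realised \<chi>"
  shows "realised (\<lambda>r. \<psi> (\<chi> r))"
proof -
  obtain g where g: "g \<in> carrier h_group"
    "\<And>a r. r \<noteq> 0 \<Longrightarrow> \<psi> r \<noteq> 0 \<and> g (int_op a \<circ> mult_op r) = int_op a \<circ> mult_op (\<psi> r)"
    using assms(1) unfolding realised_def by blast
  obtain h where h: "h \<in> carrier h_group"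
    "\<And>a r. r \<noteq> 0 \<Longrightarrow> \<chi> r \<noteq> 0 \<and> h (int_op a \<circ> mult_op r) = int_op a \<circ> mult_op (\<chi> r)"
    using assms(2) unfolding realised_def by blast
  have "\<psi> (\<chi> r) \<noteq> 0 \<and>
      (g \<otimes>\<^bsub>h_group\<^esub> h) (int_op a \<circ> mult_op r) = int_op a \<circ> mult_op (\<psi> (\<chi> r))"
    if "r \<noteq> 0" for a r
  proof -
    have "int_op a \<circ> mult_op r \<in> ops"
      using that by (auto simp: ops_def)
    then show ?thesis
      using that g h by (simp add: h_group_mult_apply del: o_apply)
  qed
  moreover have "g \<otimes>\<^bsub>h_group\<^esub> h \<in> carrier h_group"
    using g(1) h(1) group.is_monoid[OF group_h_group] by (blast intro: monoid.m_closed)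
  ultimately show ?thesis
    unfolding realised_def by blast
qed

definition shear :: "'a::field_char_0 \<Rightarrow> ('a \<Rightarrow> 'a) \<Rightarrow> 'a poly \<Rightarrow> 'a poly \<Rightarrow> 'a poly"
  where "shear b f s r = r + smult (f (poly r b)) s"

lemma realised_shear_pow:
  assumes "poly s b = 0" "k = 1 \<or> k = 2"
  shows "realised (shear b (\<lambda>y. y ^ k) s)"
proof -
  have "h_pow k b s \<in> carrier h_group"
    using assms by (auto simp: h_group_def intro!: generate.incl)
  moreover have "k > 0"
    using assms(2) by auto
  ultimately show ?thesis
    unfolding realised_def shear_def using assms(1)
    by (intro bexI[of _ "h_pow k b s"]) (auto simp: h_pow_apply dest: add_smult_value_nonzero)
qed

definition shear_profiles :: "'a::field_char_0 \<Rightarrow> ('a \<Rightarrow> 'a) set"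
  where "shear_profiles b = {f. \<forall>s. poly s b = 0 \<longrightarrow> realised (shear b f s)}"

lemma shear_profiles_id: "(\<lambda>y. y) \<in> shear_profiles b"
  using realised_shear_pow[where b = b and k = 1] by (simp add: shear_profiles_def)

text \<open>A scalar can be moved from the profile to \<open>s\<close>; this is where quantifying over all \<open>s\<close> in
  \<^const>\<open>shear_profiles\<close> pays off.\<close>

lemma shear_profiles_scale:
  assumes "f \<in> shear_profiles b"
  shows "(\<lambda>y. c * f y) \<in> shear_profiles b"
proof -
  have "shear b (\<lambda>y. c * f y) s = shear b f (smult c s)" for s
    by (simp add: shear_def fun_eq_iff mult.commute)
  then show ?thesis
    using assms by (simp add: shear_profiles_def)
qed

lemma shear_profiles_add:
  assumes "f \<in> shear_profiles b" "g \<in> shear_profiles b"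
  shows "(\<lambda>y. f y + g y) \<in> shear_profiles b"
proof -
  have "shear b (\<lambda>y. f y + g y) s = (\<lambda>r. shear b f s (shear b g s r))" if "poly s b = 0" for s
    using that by (simp add: shear_def fun_eq_iff smult_add_left)
  then show ?thesis
    using assms by (simp add: shear_profiles_def realised_comp)
qed

lemma shear_profiles_diff:
  assumes "f \<in> shear_profiles b" "g \<in> shear_profiles b"
  shows "(\<lambda>y. f y - g y) \<in> shear_profiles b"
  using shear_profiles_add[OF assms(1) shear_profiles_scale[OF assms(2), of "- 1"]] by simp

text \<open>The conjugation argument behind closure under squaring. It needs a direction \<open>t\<close> that changes neither
  the value at \<open>b\<close> nor the value at the auxiliary point \<open>c\<close>.\<close>

lemma realised_shear_square_aux:
  assumes f: "f \<in> shear_profiles b" and t: "poly t b = 0" "poly t c = 0" and "b \<noteq> c"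
  shows "realised (shear b (\<lambda>y. f y ^ 2) t)"
proof -
  define s where "s = smult (1 / (c - b)) [:- b, 1:]"
  have s: "poly s b = 0" "poly s c = 1"
    using \<open>b \<noteq> c\<close> by (simp_all add: s_def flip: diff_divide_distrib)
  define u where "u = smult (1 / 2) t"
  have u: "poly u b = 0" "poly u c = 0"
    using t by (simp_all add: u_def)
  define A where "A = shear b f s"
  define A' where "A' = shear b f (- s)"
  define B where "B = shear c (\<lambda>y. y ^ 2) u"
  define C where "C = shear c (\<lambda>y. y ^ 2) (- t)"
  have AA: "realised A" "realised A'"
    using f s by (simp_all add: A_def A'_def shear_profiles_def)
  have BC: "realised B" "realised C"
    unfolding B_def C_def using t u by (auto intro!: realised_shear_pow)
  \<comment> \<open>\<open>A\<close> adds \<open>f(r(b))\<close> to \<open>r(c)\<close>, \<open>B\<close> sees the new value, and \<open>A'\<close> undoes \<open>A\<close> because \<open>B\<close> leaves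
    \<open>r(b)\<close> alone; in the second product the signs are exchanged.\<close>
  have 1: "A' (B (A r)) = r + smult ((poly r c + f (poly r b)) ^ 2) u" for r
    using s u by (simp add: A_def A'_def B_def shear_def)
  have 2: "A (B (A' r)) = r + smult ((poly r c - f (poly r b)) ^ 2) u" for r
    using s u by (simp add: A_def A'_def B_def shear_def)
  have "C (A (B (A' (A' (B (A r)))))) = shear b (\<lambda>y. f y ^ 2) t r" for r
  proof -
    define x where "x = poly r c"
    define y where "y = f (poly r b)"
    have "C (A (B (A' (A' (B (A r)))))) =
        r + smult ((x + y) ^ 2) u + smult ((x - y) ^ 2) u + smult (x ^ 2) (- t)"
      unfolding 1 2 C_def shear_def x_def y_def using t u by simp
    also have "\<dots> = r + smult (((x + y) ^ 2 + (x - y) ^ 2) / 2 - x ^ 2) t"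
      by (simp add: u_def smult_add_left[symmetric] smult_diff_left add_divide_distrib algebra_simps)
    also have "((x + y) ^ 2 + (x - y) ^ 2) / 2 - x ^ 2 = y ^ 2"
      by (simp add: power2_eq_square field_simps)
    finally show ?thesis
      by (simp add: shear_def y_def)
  qed
  moreover have "realised (\<lambda>r. C (A (B (A' (A' (B (A r)))))))"
    by (rule realised_comp[OF BC(2) realised_comp[OF AA(1) realised_comp[OF BC(1)
          realised_comp[OF AA(2) realised_comp[OF AA(2) realised_comp[OF BC(1) AA(1)]]]]]])
  ultimately show ?thesis
    by presburger
qed

text \<open>The condition at the auxiliary point disappears by splitting \<open>t\<close> into two parts, both vanishing at \<open>b\<close>,
  one vanishing at \<open>b + 1\<close> and the other at \<open>b + 2\<close>.\<close>

lemma shear_profiles_square: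
  assumes "f \<in> shear_profiles b"
  shows "(\<lambda>y. f y ^ 2) \<in> shear_profiles b"
proof -
  have "realised (shear b (\<lambda>y. f y ^ 2) t)" if t: "poly t b = 0" for t
  proof -
    \<comment> \<open>The scalar is chosen so that \<open>t2\<close> and \<open>t\<close> agree at \<open>b + 1\<close>, where the product takes the value \<open>- 1\<close>.\<close>
    define t2 where "t2 = smult (- poly t (b + 1)) ([:- b, 1:] * [:- (b + 2), 1:])"
    define t1 where "t1 = t - t2"
    have "poly t2 b = 0" "poly t2 (b + 2) = 0" "poly t1 b = 0" "poly t1 (b + 1) = 0"
      using t by (simp_all add: t1_def t2_def algebra_simps)
    then have "realised (shear b (\<lambda>y. f y ^ 2) t1)" "realised (shear b (\<lambda>y. f y ^ 2) t2)"
      using realised_shear_square_aux[OF assms, of t1 "b + 1"]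
        realised_shear_square_aux[OF assms, of t2 "b + 2"] by simp_all
    then have "realised (\<lambda>r. shear b (\<lambda>y. f y ^ 2) t1 (shear b (\<lambda>y. f y ^ 2) t2 r))"
      by (rule realised_comp)
    moreover have "(\<lambda>r. shear b (\<lambda>y. f y ^ 2) t1 (shear b (\<lambda>y. f y ^ 2) t2 r)) =
        shear b (\<lambda>y. f y ^ 2) t"
      using \<open>poly t2 b = 0\<close> by (simp add: shear_def t1_def fun_eq_iff smult_diff_right)
    ultimately show ?thesis
      by simp
  qed
  then show ?thesis
    by (simp add: shear_profiles_def)
qed

lemma shear_profiles_mult:
  assumes "f \<in> shear_profiles b" "g \<in> shear_profiles b"
  shows "(\<lambda>y. f y * g y) \<in> shear_profiles b"
proof -
  have "(\<lambda>y. 1 / 2 * ((f y + g y) ^ 2 - f y ^ 2 - g y ^ 2)) \<in> shear_profiles b"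
    by (intro shear_profiles_scale shear_profiles_diff shear_profiles_square shear_profiles_add assms)
  moreover have "(\<lambda>y. 1 / 2 * ((f y + g y) ^ 2 - f y ^ 2 - g y ^ 2)) = (\<lambda>y. f y * g y)"
    by (simp add: fun_eq_iff power2_eq_square field_simps)
  ultimately show ?thesis
    by simp
qed

text \<open>The profile that kills the values in \<open>W\<close>, to be used when the polynomials to be fixed have their values
  there. The factor \<open>y\<close> is unavoidable: all profiles obtained from \<open>y\<close> and \<open>y\<^sup>2\<close> vanish at \<open>0\<close>.\<close>

lemma shear_profile_isolating:
  assumes "finite W"
  shows "(\<lambda>y. y * (\<Prod>w\<in>W. y - w)) \<in> shear_profiles b"
  using assms
proof induction
  case empty
  then show ?case
    by (simp add: shear_profiles_id)
next
  case (insert w W)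
  let ?f = "\<lambda>y. y * (\<Prod>w\<in>W. y - w)"
  have "(\<lambda>y. y * ?f y - w * ?f y) \<in> shear_profiles b"
    by (intro shear_profiles_diff shear_profiles_scale shear_profiles_mult shear_profiles_id insert.IH)
  moreover have "(\<lambda>y. y * ?f y - w * ?f y) = (\<lambda>y. y * (\<Prod>v\<in>insert w W. y - v))"
    using insert.hyps by (simp add: fun_eq_iff algebra_simps)
  ultimately show ?case
    by simp
qed

section \<open>Moving one polynomial, then a tuple\<close>

lemma ex_nonroot:
  fixes D :: "'a::field_char_0 poly set"
  assumes "finite D" "0 \<notin> D"
  shows "\<exists>b. \<forall>p\<in>D. poly p b \<noteq> 0"
proof -
  have "finite (\<Union>p\<in>D. {x. poly p x = 0})"
    using assms by (auto intro!: poly_roots_finite)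
  then obtain b where "b \<notin> (\<Union>p\<in>D. {x. poly p x = 0})"
    using ex_new_if_finite infinite_UNIV_char_0 by blast
  then show ?thesis
    by blast
qed

text \<open>A single shear whose profile vanishes at every \<open>p(b)\<close> with \<open>p\<close> in \<open>A\<close>, scaled so that it adds
  exactly \<open>t\<close> to \<open>r\<close>.\<close>

lemma translate_one:
  fixes r t :: "'a::field_char_0 poly"
  assumes "finite A" and "poly t b = 0"
    and "poly r b \<noteq> 0" and "\<And>p. p \<in> A \<Longrightarrow> poly r b \<noteq> poly p b"
  obtains \<psi> where "realised \<psi>" "\<psi> r = r + t" "\<And>p. p \<in> A \<Longrightarrow> \<psi> p = p"
proof -
  define W where "W = (\<lambda>p. poly p b) ` A"
  have "finite W"
    using assms(1) by (simp add: W_def)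
  define f where "f = (\<lambda>y. y * (\<Prod>w\<in>W. y - w))"
  define c where "c = f (poly r b)"
  have "c \<noteq> 0"
    using assms(3,4) \<open>finite W\<close> by (auto simp: c_def f_def W_def)
  have zero: "f (poly p b) = 0" if "p \<in> A" for p
    using that \<open>finite W\<close> by (auto simp: f_def W_def)
  have "realised (shear b f (smult (1 / c) t))"
    using shear_profile_isolating[OF \<open>finite W\<close>, of b] assms(2)
    by (simp add: shear_profiles_def f_def)
  moreover have "shear b f (smult (1 / c) t) r = r + t"
    using \<open>c \<noteq> 0\<close> by (simp add: shear_def c_def[symmetric])
  moreover have "shear b f (smult (1 / c) t) p = p" if "p \<in> A" for p
    using zero[OF that] by (simp add: shear_def)
  ultimately show thesis
    by (rule that)
qed

text \<open>A translation at \<open>b\<close> keeps the value at \<open>b\<close>, so one step is not enough in general. The first step, at a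
  point \<open>b\<close> generic for \<open>r\<close>, corrects the value at a second point \<open>c\<close>, generic for \<open>q\<close>. The intermediate
  polynomial has the same value as \<open>q\<close> at \<open>c\<close>, so \<open>c\<close> is generic for it too, and the
  remaining difference vanishes at \<open>c\<close>.\<close>

lemma move_one:
  fixes r q :: "'a::field_char_0 poly"
  assumes "finite A" and r: "r \<notin> insert 0 A" and q: "q \<notin> insert 0 A"
  obtains \<psi> where "realised \<psi>" "\<psi> r = q" "\<And>p. p \<in> A \<Longrightarrow> \<psi> p = p"
proof -
  have "0 \<notin> insert r ((\<lambda>p. r - p) ` A)"
    using r by auto
  then obtain b where "\<forall>p \<in> insert r ((\<lambda>p. r - p) ` A). poly p b \<noteq> 0"
    using ex_nonroot[of "insert r ((\<lambda>p. r - p) ` A)"] assms(1) by blast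
  then have b: "poly r b \<noteq> 0" "\<And>p. p \<in> A \<Longrightarrow> poly r b \<noteq> poly p b"
    by auto
  have "0 \<notin> insert [:- b, 1:] (insert q ((\<lambda>p. q - p) ` A))"
    using q by auto
  then obtain c where "\<forall>p \<in> insert [:- b, 1:] (insert q ((\<lambda>p. q - p) ` A)). poly p c \<noteq> 0"
    using ex_nonroot[of "insert [:- b, 1:] (insert q ((\<lambda>p. q - p) ` A))"] assms(1) by blast
  then have c: "c \<noteq> b" "poly q c \<noteq> 0" "\<And>p. p \<in> A \<Longrightarrow> poly q c \<noteq> poly p c"
    by auto
  define d where "d = poly (q - r) c / (c - b)"
  define t where "t = smult d [:- b, 1:]"
  have "poly t c = d * (c - b)"
    by (simp add: t_def algebra_simps)
  then have t: "poly t b = 0" "poly t c = poly (q - r) c"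
    using c(1) by (simp_all add: t_def d_def)
  obtain \<psi> where \<psi>: "realised \<psi>" "\<psi> r = r + t" "\<And>p. p \<in> A \<Longrightarrow> \<psi> p = p"
    using translate_one[of A t b r] assms(1) t(1) b by metis
  have rtc: "poly (r + t) c = poly q c"
    using t by simp
  obtain \<chi> where \<chi>: "realised \<chi>" "\<chi> (r + t) = r + t + (q - r - t)" "\<And>p. p \<in> A \<Longrightarrow> \<chi> p = p"
  proof (rule translate_one[of A "q - r - t" c "r + t"])
    show "poly (q - r - t) c = 0"
      using t by simp
    show "poly (r + t) c \<noteq> 0" "\<And>p. p \<in> A \<Longrightarrow> poly (r + t) c \<noteq> poly p c"
      unfolding rtc using c by auto
  qed (use assms(1) in auto)
  show thesis
  proof (rule that)
    show "realised (\<lambda>p. \<chi> (\<psi> p))"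
      using \<chi>(1) \<psi>(1) by (rule realised_comp)
    show "\<chi> (\<psi> r) = q"
      using \<chi>(2) \<psi>(2) by simp
    show "\<chi> (\<psi> p) = p" if "p \<in> A" for p
      using that \<chi>(3) \<psi>(3) by simp
  qed
qed

text \<open>Disjointness ensures that a target entry is never occupied by an entry that has still to be moved. The
  set \<open>A\<close> makes the induction work: it collects the entries that are already in place.\<close>

lemma move_disjoint_tuples:
  fixes rs qs :: "'a::field_char_0 poly list"
  assumes "length rs = length qs" "distinct rs" "distinct qs" "set rs \<inter> set qs = {}"
    and "finite A" "set rs \<inter> insert 0 A = {}" "set qs \<inter> insert 0 A = {}"
  shows "\<exists>\<psi>. realised \<psi> \<and> map \<psi> rs = qs \<and> (\<forall>p\<in>A. \<psi> p = p)"
  using assms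
proof (induction rs qs arbitrary: A rule: list_induct2)
  case Nil
  then show ?case
    using realised_id by auto
next
  case (Cons r rs q qs)
  obtain \<psi> where \<psi>: "realised \<psi>" "\<psi> r = q" "\<And>p. p \<in> A \<union> set rs \<Longrightarrow> \<psi> p = p"
    using move_one[of "A \<union> set rs" r q] Cons.prems by auto
  obtain \<chi> where \<chi>: "realised \<chi>" "map \<chi> rs = qs" "\<forall>p\<in>insert q A. \<chi> p = p"
    using Cons.IH[of "insert q A"] Cons.prems by auto
  have "map (\<lambda>p. \<chi> (\<psi> p)) (r # rs) = q # qs"
    using \<chi>(2,3) \<psi>(2,3) by (auto cong: map_cong)
  moreover have "\<forall>p\<in>A. \<chi> (\<psi> p) = p"
    using \<chi>(3) \<psi>(3) by auto
  ultimately show ?case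
    using realised_comp[OF \<chi>(1) \<psi>(1)] by (intro exI[of _ "\<lambda>p. \<chi> (\<psi> p)"] conjI)
qed

text \<open>Tuples that overlap, such as two orderings of the same entries, are joined through a fresh tuple
  disjoint from both.\<close>

lemma move_tuples:
  fixes rs qs :: "'a::field_char_0 poly list"
  assumes "length rs = length qs" "distinct rs" "distinct qs" "0 \<notin> set rs" "0 \<notin> set qs"
  obtains \<psi> where "realised \<psi>" "map \<psi> rs = qs"
proof -
  have "infinite (UNIV - (insert 0 (set rs \<union> set qs)))"
    using infinite_UNIV_char_0[where 'a = "'a poly"] by (intro Diff_infinite_finite) auto
  then obtain U where U: "finite U" "card U = length qs" "U \<subseteq> UNIV - insert 0 (set rs \<union> set qs)"
    using infinite_arbitrarily_large by blast
  then obtain us where us: "set us = U" "distinct us"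
    using finite_distinct_list by blast
  then have "length us = length qs"
    using U(2) distinct_card by metis
  have "set rs \<inter> set us = {}" "set us \<inter> set qs = {}" "0 \<notin> set us"
    using U(3) us(1) by auto
  then obtain \<psi> \<chi> where "realised \<psi>" "map \<psi> rs = us" "realised \<chi>" "map \<chi> us = qs"
    using move_disjoint_tuples[of rs us "{}"] move_disjoint_tuples[of us qs "{}"]
      assms us(2) \<open>length us = length qs\<close> by auto
  then have "realised (\<lambda>p. \<chi> (\<psi> p))" "map (\<lambda>p. \<chi> (\<psi> p)) rs = qs"
    using realised_comp[of \<chi> \<psi>] by auto
  then show thesis
    by (rule that)
qed

theorem theorem4p23:
  fixes a :: "'a::field_char_0"
  shows "infinitely_transitive_action h_group (ops_at a) (\<lambda>g. restrict g (ops_at a))"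
  unfolding infinitely_transitive_action_def
proof (intro conjI allI)
  show "group_action h_group (ops_at a) (\<lambda>g. restrict g (ops_at a))"
    by (rule group_action_h_group)
  fix m
  let ?J = "\<lambda>r. int_op a \<circ> mult_op r"
  have lists: "\<exists>rs. xs = map ?J rs \<and> length rs = m \<and> distinct rs \<and> 0 \<notin> set rs"
    if "xs \<in> distinct_tuples m (ops_at a)" for xs
  proof -
    have "\<forall>x \<in> set xs. \<exists>r. r \<noteq> 0 \<and> x = ?J r"
      using that by (auto simp: distinct_tuples_def ops_at_def)
    then obtain R where R: "\<And>x. x \<in> set xs \<Longrightarrow> R x \<noteq> 0 \<and> x = ?J (R x)"
      by metis
    then have "xs = map ?J (map R xs)"
      by (simp add: map_idI)
    moreover have "distinct (map R xs)"
    proof -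
      have "distinct (map ?J (map R xs))"
        using that calculation by (simp add: distinct_tuples_def)
      then show ?thesis
        unfolding distinct_map by blast
    qed
    ultimately show ?thesis
      using that R by (intro exI[of _ "map R xs"]) (auto simp: distinct_tuples_def)
  qed
  have "\<exists>g\<in>carrier h_group.
      (\<lambda>xs\<in>distinct_tuples m (ops_at a). map (restrict g (ops_at a)) xs) xs = ys"
    if xs: "xs \<in> distinct_tuples m (ops_at a)" and ys: "ys \<in> distinct_tuples m (ops_at a)" for xs ys
  proof -
    obtain rs where rs: "xs = map ?J rs" "length rs = m" "distinct rs" "0 \<notin> set rs"
      using lists[OF xs] by blast
    obtain qs where qs: "ys = map ?J qs" "length qs = m" "distinct qs" "0 \<notin> set qs"
      using lists[OF ys] by blast
    obtain \<psi> where \<psi>: "realised \<psi>" "map \<psi> rs = qs"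
      using move_tuples[of rs qs] rs qs by auto
    then obtain g where g: "g \<in> carrier h_group" "\<And>r. r \<noteq> 0 \<Longrightarrow> g (?J r) = ?J (\<psi> r)"
      unfolding realised_def by blast
    have "restrict g (ops_at a) (?J r) = ?J (\<psi> r)" if "r \<in> set rs" for r
    proof -
      have "r \<noteq> 0"
        using that rs(4) by auto
      then show ?thesis
        using g(2) by (auto simp: ops_at_def)
    qed
    then have "map (restrict g (ops_at a)) xs = ys"
      unfolding rs(1) qs(1) \<psi>(2)[symmetric] by simp
    then show ?thesis
      using g(1) xs by auto
  qed
  then show "transitive_action h_group (distinct_tuples m (ops_at a))
      (\<lambda>g. \<lambda>xs\<in>distinct_tuples m (ops_at a). map (restrict g (ops_at a)) xs)"
    unfolding transitive_action_def transitive_action_axioms_def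
    using group_action_distinct_tuples[OF group_action_h_group] by blast
qed

end
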